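(* Let $\mathbf{L}$ be a set of data words. Then $\mathbf{L}$ is not definable in MTL (i.e., there is no MTL-formula satisfied by exactly the data words in $\mathbf{L}$) if and only if for every $\mathcal{I}\in\mathsf{FCons}(\mathbb{Z})$ and every $k\in\mathbb{N}$ there exist data words $w_0\in\mathbf{L}$ and $w_1\notin\mathbf{L}$ such that Duplicator has a winning strategy in the game $\mathrm{MG}^{\mathcal{I}}_k(w_0,0,w_1,0)$.
   Context: Data words: infinite sequences $w=(P_0,d_0)(P_1,d_1)\dots$, $P_i\subseteq\mathcal{P}$ ($\mathcal{P}$ a finite set of propositions), $d_i\in\mathbb{N}$; write $P^w_i,d^w_i$. MTL formulas: $\varphi::=p\mid\neg\varphi\mid\varphi_1\wedge\varphi_2\mid\varphi_1\mathsf{U}_I\varphi_2$ where $I$ is an integer interval with endpoints in $\mathbb{Z}\cup\{\pm\infty\}$; $(w,i)\models p$ iff $p\in P_i$, $(w,i)\models\varphi_1\mathsf{U}_I\varphi_2$ iff there is $j>i$ with $(w,j)\models\varphi_2$, $d_j-d_i\in I$, and $(w,k)\models\varphi_1$ for all $i<k<j$; $w\models\varphi$ iff $(w,0)\models\varphi$. $\mathsf{FCons}(\mathbb{Z})$ is the family of sets $S\cup\{-\infty,+\infty\}$ with $S\subseteq\mathbb{Z}$ finite. Regions: $m,n\in\mathbb{Z}$ are in the same region w.r.t. $\mathcal{I}$ if either $m=n\in\mathcal{I}$, or $m,n\notin\mathcal{I}$ and they lie strictly between the same two consecutive elements of $\mathcal{I}$. Positions $i_0$ of $w_0$, $i_1$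 of $w_1$ agree in the propositional variables if $P^{w_0}_{i_0}=P^{w_1}_{i_1}$. Game $\mathrm{MG}^{\mathcal{I}}_k(w_0,i_0,w_1,i_1)$: if $k=0$, Spoiler wins iff $i_0,i_1$ do not agree in the propositional variables, otherwise Duplicator wins. If $k>0$: (1) if $i_0,i_1$ do not agree in the propositional variables Spoiler wins; otherwise Spoiler picks $l\in\{0,1\}$ and $i'_l>i_l$ in $w_l$. (2) Duplicator picks $i'_{1-l}>i_{1-l}$ in $w_{1-l}$; Spoiler wins unless $i'_0,i'_1$ agree in the propositional variables and $d^{w_0}_{i'_0}-d^{w_0}_{i_0}$, $d^{w_1}_{i'_1}-d^{w_1}_{i_1}$ are in the same region w.r.t. $\mathcal{I}$. (3) Spoiler either continues with $\mathrm{MG}^{\mathcal{I}}_{k-1}(w_0,i'_0,w_1,i'_1)$, or (4) picks $i''_{1-l}$ with $i_{1-l}<i''_{1-l}<i'_{1-l}$, and Duplicator must pick $i''_l$ with $i_l<i''_l<i'_l$ such that $i''_0,i''_1$ agree in the propositional variables, else Spoiler wins; then (5) play continues with $\mathrm{MG}^{\mathcal{I}}_{k-1}(w_0,i''_0,w_1,i''_1)$. Duplicator has a winning strategy if she can avoid Spoiler winning in every round whatever Spoiler does. *)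

theory Defs
  imports Main "HOL-Library.Extended"
begin

text \<open>The finite set of propositions is the universe of a type \<open>'p :: finite\<close>.\<close>

type_synonym 'p data_word = "nat \<Rightarrow> 'p set \<times> nat"

definition props :: "'p data_word \<Rightarrow> nat \<Rightarrow> 'p set" where
  "props w i = fst (w i)"

definition datum :: "'p data_word \<Rightarrow> nat \<Rightarrow> int" where
  "datum w i = int (snd (w i))"

text \<open>Integer intervals are given by their endpoints, which range over the integers extended
  by \<open>Minf\<close> and \<open>Pinf\<close>; each end may be closed (\<open>C\<close>) or open (\<open>O\<close>).\<close>

datatype zinterval =
    Ivl_CC "int extended" "int extended"
  | Ivl_CO "int extended" "int extended"
  | Ivl_OC "int extended" "int extended"
  | Ivl_OO "int extended" "int extended"

primrec zset :: "zinterval \<Rightarrow> int set" where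
  "zset (Ivl_CC a b) = {n. a \<le> Fin n \<and> Fin n \<le> b}"
| "zset (Ivl_CO a b) = {n. a \<le> Fin n \<and> Fin n < b}"
| "zset (Ivl_OC a b) = {n. a < Fin n \<and> Fin n \<le> b}"
| "zset (Ivl_OO a b) = {n. a < Fin n \<and> Fin n < b}"

datatype 'p mtl =
    Atom 'p
  | Neg "'p mtl"
  | And "'p mtl" "'p mtl"
  | Until "'p mtl" zinterval "'p mtl"

primrec sat_at :: "'p data_word \<Rightarrow> nat \<Rightarrow> 'p mtl \<Rightarrow> bool" where
  "sat_at w i (Atom p) \<longleftrightarrow> p \<in> props w i"
| "sat_at w i (Neg \<phi>) \<longleftrightarrow> \<not> sat_at w i \<phi>"
| "sat_at w i (And \<phi> \<psi>) \<longleftrightarrow> sat_at w i \<phi> \<and> sat_at w i \<psi>"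
| "sat_at w i (Until \<phi> I \<psi>) \<longleftrightarrow>
     (\<exists>j>i. sat_at w j \<psi> \<and> datum w j - datum w i \<in> zset I \<and>
            (\<forall>k. i < k \<and> k < j \<longrightarrow> sat_at w k \<phi>))"

definition sat :: "'p data_word \<Rightarrow> 'p mtl \<Rightarrow> bool" where
  "sat w \<phi> \<longleftrightarrow> sat_at w 0 \<phi>"

definition mtl_definable :: "'p data_word set \<Rightarrow> bool" where
  "mtl_definable L \<longleftrightarrow> (\<exists>\<phi>. \<forall>w. sat w \<phi> \<longleftrightarrow> w \<in> L)"

definition FCons :: "int extended set set" where
  "FCons = {Fin ` S \<union> {Minf, Pinf} | S. finite S}"

definition consecutive :: "int extended set \<Rightarrow> int extended \<Rightarrow> int extended \<Rightarrow> bool" where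
  "consecutive \<I> a b \<longleftrightarrow> a \<in> \<I> \<and> b \<in> \<I> \<and> a < b \<and> \<not> (\<exists>c\<in>\<I>. a < c \<and> c < b)"

definition same_region :: "int extended set \<Rightarrow> int \<Rightarrow> int \<Rightarrow> bool" where
  "same_region \<I> m n \<longleftrightarrow>
     m = n \<and> Fin m \<in> \<I> \<or>
     Fin m \<notin> \<I> \<and> Fin n \<notin> \<I> \<and>
       (\<exists>a b. consecutive \<I> a b \<and> a < Fin m \<and> Fin m < b \<and> a < Fin n \<and> Fin n < b)"

text \<open>
  The two words of a game, and a pair of positions in them, are indexed by \<open>bool\<close>:
  \<open>False\<close> stands for side 0 and \<open>True\<close> for side 1, so that \<open>\<not> l\<close> is the side \<open>1 - l\<close>.
\<close>

definition agree :: "(bool \<Rightarrow> 'p data_word) \<Rightarrow> (bool \<Rightarrow> nat) \<Rightarrow> bool" where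
  "agree w i \<longleftrightarrow> props (w False) (i False) = props (w True) (i True)"

definition step_same_region ::
  "int extended set \<Rightarrow> (bool \<Rightarrow> 'p data_word) \<Rightarrow> (bool \<Rightarrow> nat) \<Rightarrow> (bool \<Rightarrow> nat) \<Rightarrow> bool" where
  "step_same_region \<I> w i i' \<longleftrightarrow>
     same_region \<I> (datum (w False) (i' False) - datum (w False) (i False))
                    (datum (w True) (i' True) - datum (w True) (i True))"

definition place :: "bool \<Rightarrow> nat \<Rightarrow> nat \<Rightarrow> bool \<Rightarrow> nat" where
  "place l a b = (\<lambda>s. if s = l then a else b)"

text \<open>
  A round begins with Spoiler's \<open>Pick l a\<close> (side \<open>l\<close>, position \<open>a\<close>), which Duplicator answers
  on side \<open>\<not> l\<close>. Spoiler then plays \<open>Continue\<close> or \<open>Between c\<close>, where \<open>c\<close> is a position on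
  side \<open>\<not> l\<close>; the latter is answered on side \<open>l\<close>.
  A strategy of Duplicator maps the list of all moves Spoiler has made so far, oldest first, to
  the position with which she answers the last one.
\<close>

datatype spoiler_move = Pick bool nat | Continue | Between nat

type_synonym duplicator_strategy = "spoiler_move list \<Rightarrow> nat"

text \<open>
  \<open>survives \<I> w \<sigma> k i\<close>: playing according to \<open>\<sigma>\<close>, Duplicator prevents Spoiler from
  winning the \<open>k\<close>-round game from the positions \<open>i\<close>, whatever Spoiler does. For the remaining
  rounds, \<open>\<sigma>\<close> is replaced by the strategy that it induces after the moves already made.
\<close>

primrec survives ::
  "int extended set \<Rightarrow> (bool \<Rightarrow> 'p data_word) \<Rightarrow> duplicator_strategy \<Rightarrow> nat \<Rightarrow> (bool \<Rightarrow> nat) \<Rightarrow> bool"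
where
  "survives \<I> w \<sigma> 0 i \<longleftrightarrow> agree w i"
| "survives \<I> w \<sigma> (Suc k) i \<longleftrightarrow>
     agree w i \<and>
     (\<forall>l a. i l < a \<longrightarrow>
        (let b = \<sigma> [Pick l a]; i' = place l a b in
           i (\<not> l) < b \<and> agree w i' \<and> step_same_region \<I> w i i' \<and>
           survives \<I> w (\<lambda>h. \<sigma> (Pick l a # Continue # h)) k i' \<and>
           (\<forall>c. i (\<not> l) < c \<and> c < b \<longrightarrow>
              (let e = \<sigma> [Pick l a, Between c]; i'' = place l e c in
                 i l < e \<and> e < a \<and> agree w i'' \<and>
                 survives \<I> w (\<lambda>h. \<sigma> (Pick l a # Between c # h)) k i''))))"

definition duplicator_wins_MG ::
  "int extended set \<Rightarrow> nat \<Rightarrow> 'p data_word \<Rightarrow> nat \<Rightarrow> 'p data_word \<Rightarrow> nat \<Rightarrow> bool" where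
  "duplicator_wins_MG \<I> k w0 i0 w1 i1 \<longleftrightarrow>
     (\<exists>\<sigma>. survives \<I> (\<lambda>s. if s then w1 else w0) \<sigma> k (\<lambda>s. if s then i1 else i0))"

end

theory Submission
  imports Defs
begin

text \<open>
  A winning strategy in the \<open>k\<close>-round game transfers every formula of until-depth at most \<open>k\<close>
  whose interval endpoints lie in \<open>\<I>\<close>: the answer to \<open>Pick\<close> transfers the witness of an until
  formula, and the answers to \<open>Between\<close> transfer the formula that holds up to that witness.
  Conversely, for each \<open>k\<close> some finite set \<open>F\<close> of formulas is such that Duplicator wins the
  \<open>k\<close>-round game from positions of the same \<open>F\<close>-type. For \<open>k + 1\<close> rounds one adds to \<open>F\<close> all
  formulas ``the type lies in \<open>S\<close> until, at distance in \<open>J\<close>, the type is \<open>T\<close>'', where \<open>J\<close>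
  ranges over the finitely many regions. If Duplicator never wins between \<open>L\<close> and its complement,
  then \<open>L\<close> is a union of \<open>F\<close>-types, and hence definable.
\<close>

section \<open>Regions and integer intervals\<close>

lemma same_region_sym: "same_region \<I> m n \<Longrightarrow> same_region \<I> n m"
  by (auto simp: same_region_def)

text \<open>Symmetry of \<open>same_region\<close> removes the fixed order of the sides, so
  Spoiler's side \<open>l\<close> can stay arbitrary in later arguments.\<close>

lemma step_same_region_iff:
  "step_same_region \<I> w i i' \<longleftrightarrow>
     same_region \<I> (datum (w l) (i' l) - datum (w l) (i l))
                    (datum (w (\<not> l)) (i' (\<not> l)) - datum (w (\<not> l)) (i (\<not> l)))"
  by (cases l) (auto simp: step_same_region_def intro: same_region_sym)

lemma finite_FCons: "\<I> \<in> FCons \<Longrightarrow> finite \<I>"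
  by (auto simp: FCons_def)

lemma place_simps [simp]: "place l a b l = a" "place l a b (\<not> l) = b"
  by (auto simp: place_def)

primrec endpoints :: "zinterval \<Rightarrow> int extended set" where
  "endpoints (Ivl_CC a b) = {a, b}"
| "endpoints (Ivl_CO a b) = {a, b}"
| "endpoints (Ivl_OC a b) = {a, b}"
| "endpoints (Ivl_OO a b) = {a, b}"

lemma finite_endpoints: "finite (endpoints J)"
  by (cases J) auto

text \<open>Two distinct numbers of a region share a gap between consecutive elements of \<I>. No
  \<open>c\<close> in \<I> lies strictly inside that gap, so \<open>c\<close> cannot separate
  them.\<close>

lemma same_region_less_iff:
  assumes "same_region \<I> m n" "c \<in> \<I>"
  shows "c < Fin m \<longleftrightarrow> c < Fin n" "Fin m < c \<longleftrightarrow> Fin n < c"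
proof -
  have "(c < Fin m \<longleftrightarrow> c < Fin n) \<and> (Fin m < c \<longleftrightarrow> Fin n < c)"
    using assms(1) unfolding same_region_def
  proof (elim disjE conjE exE)
    fix a b
    assume mn: "a < Fin m" "Fin m < b" "a < Fin n" "Fin n < b"
      and "consecutive \<I> a b"
    with assms(2) have "c \<le> a \<or> b \<le> c"
      by (meson consecutive_def not_less)
    with mn show ?thesis
      by (meson le_less_trans less_le_trans less_asym)
  qed simp
  then show "c < Fin m \<longleftrightarrow> c < Fin n" "Fin m < c \<longleftrightarrow> Fin n < c"
    by auto
qed

lemma same_region_zset_iff:
  assumes "same_region \<I> m n" "endpoints J \<subseteq> \<I>"
  shows "m \<in> zset J \<longleftrightarrow> n \<in> zset J"
  using assms
  by (cases J) (simp_all add: same_region_less_iff[OF assms(1)] flip: not_less)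

lemma finite_intervals: "finite \<I> \<Longrightarrow> finite {J. endpoints J \<subseteq> \<I>}"
proof -
  assume fin: "finite \<I>"
  have "{J. endpoints J \<subseteq> \<I>} \<subseteq>
    (\<lambda>(f, a, b). f a b) ` ({Ivl_CC, Ivl_CO, Ivl_OC, Ivl_OO} \<times> \<I> \<times> \<I>)"
  proof
    fix J
    assume "J \<in> {J. endpoints J \<subseteq> \<I>}"
    then show "J \<in> (\<lambda>(f, a, b). f a b) ` ({Ivl_CC, Ivl_CO, Ivl_OC, Ivl_OO} \<times> \<I> \<times> \<I>)"
      by (cases J) (force simp: image_iff)+
  qed
  with fin show ?thesis
    by (auto intro: finite_subset)
qed

text \<open>A region is a singleton or an open gap between neighbours in \<I>. Hence an until
  formula can confine Duplicator's distance to the region of Spoiler's distance.\<close>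

lemma region_interval:
  assumes "\<I> \<in> FCons"
  obtains J where "endpoints J \<subseteq> \<I>" "m \<in> zset J" "\<And>n. n \<in> zset J \<Longrightarrow> same_region \<I> m n"
proof (cases "Fin m \<in> \<I>")
  case True
  then show ?thesis
    by (intro that[of "Ivl_CC (Fin m) (Fin m)"]) (auto simp: same_region_def)
next
  case False
  define A where "A = {x \<in> \<I>. x < Fin m}"
  define B where "B = {x \<in> \<I>. Fin m < x}"
  have fin: "finite A" "finite B"
    using finite_FCons[OF assms] by (auto simp: A_def B_def)
  \<comment> \<open>The infinite elements of \<I> guarantee a neighbour of \<open>m\<close> on each
    side.\<close>
  have "Minf \<in> A" "Pinf \<in> B"
    using assms by (auto simp: A_def B_def FCons_def)
  then have ne: "A \<noteq> {}" "B \<noteq> {}"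
    by auto
  have "Max A \<in> A" "Min B \<in> B"
    using fin ne by auto
  then have AB: "Max A \<in> \<I>" "Min B \<in> \<I>" "Max A < Fin m" "Fin m < Min B"
    by (auto simp: A_def B_def)
  have gap: "c \<le> Max A \<or> Min B \<le> c" if "c \<in> \<I>" for c
  proof -
    have "c \<in> A \<or> c \<in> B"
      using that False unfolding A_def B_def by (metis (mono_tags, lifting) mem_Collect_eq linorder_neqE)
    then show ?thesis
      using fin by auto
  qed
  then have "consecutive \<I> (Max A) (Min B)"
    using AB by (auto simp: consecutive_def dest: gap)
  moreover have "Fin n \<notin> \<I>" if "Max A < Fin n" "Fin n < Min B" for n
    using that gap[of "Fin n"] by auto
  ultimately show ?thesis
    using AB False
    by (intro that[of "Ivl_OO (Max A) (Min B)"]) (auto simp: same_region_def)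
qed

section \<open>From winning strategies to equivalence of formulas\<close>

primrec depth :: "'p mtl \<Rightarrow> nat" where
  "depth (Atom p) = 0"
| "depth (Neg \<phi>) = depth \<phi>"
| "depth (And \<phi> \<psi>) = max (depth \<phi>) (depth \<psi>)"
| "depth (Until \<phi> J \<psi>) = Suc (max (depth \<phi>) (depth \<psi>))"

primrec constants :: "'p mtl \<Rightarrow> int extended set" where
  "constants (Atom p) = {}"
| "constants (Neg \<phi>) = constants \<phi>"
| "constants (And \<phi> \<psi>) = constants \<phi> \<union> constants \<psi>"
| "constants (Until \<phi> J \<psi>) = endpoints J \<union> constants \<phi> \<union> constants \<psi>"

lemma finite_constants: "finite (constants \<phi>)"
  by (induction \<phi>) (auto simp: finite_endpoints)

lemma survives_agree: "survives \<I> w \<sigma> k i \<Longrightarrow> agree w i"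
  by (cases k) auto

text \<open>The strategy, the number of rounds and the positions vary in the induction, because an
  until spends one round and leads to an induced strategy at new positions.\<close>

lemma survives_sat_at_iff:
  assumes "survives \<I> w \<sigma> k i" "depth \<phi> \<le> k" "constants \<phi> \<subseteq> \<I>"
  shows "sat_at (w l) (i l) \<phi> \<longleftrightarrow> sat_at (w (\<not> l)) (i (\<not> l)) \<phi>"
  using assms
proof (induction \<phi> arbitrary: \<sigma> k i l)
  case (Atom p)
  show ?case
    using survives_agree[OF Atom(1)] by (cases l) (auto simp: agree_def)
next
  case (Neg \<phi>)
  from Neg.IH[OF Neg.prems(1), of l] Neg.prems(2,3) show ?case
    by (simp only: depth.simps constants.simps sat_at.simps)
next
  case (And \<phi> \<psi>)
  from And.IH[OF And.prems(1), of l] And.prems(2,3) show ?case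
    by (simp only: depth.simps constants.simps sat_at.simps max.bounded_iff Un_subset_iff)
next
  case (Until \<phi> J \<psi>)
  from Until.prems obtain k' where k: "k = Suc k'" "depth \<phi> \<le> k'" "depth \<psi> \<le> k'"
    by (cases k) auto
  have const: "constants \<phi> \<subseteq> \<I>" "constants \<psi> \<subseteq> \<I>" "endpoints J \<subseteq> \<I>"
    using Until.prems by auto
  \<comment> \<open>One implication for an arbitrary side suffices: the converse is its instance at
    the opposite side.\<close>
  have transfer: "sat_at (w (\<not> l)) (i (\<not> l)) (Until \<phi> J \<psi>)"
    if sat: "sat_at (w l) (i l) (Until \<phi> J \<psi>)" for l
  proof -
    from sat obtain a where a: "i l < a" "sat_at (w l) a \<psi>"
      "datum (w l) a - datum (w l) (i l) \<in> zset J"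
      and before: "\<And>e. i l < e \<Longrightarrow> e < a \<Longrightarrow> sat_at (w l) e \<phi>"
      by auto
    define b where "b = \<sigma> [Pick l a]"
    have b: "i (\<not> l) < b" "step_same_region \<I> w i (place l a b)"
      "survives \<I> w (\<lambda>h. \<sigma> (Pick l a # Continue # h)) k' (place l a b)"
      and between: "\<And>c. i (\<not> l) < c \<Longrightarrow> c < b \<Longrightarrow>
        (let e = \<sigma> [Pick l a, Between c] in i l < e \<and> e < a \<and>
           survives \<I> w (\<lambda>h. \<sigma> (Pick l a # Between c # h)) k' (place l e c))"
      using Until.prems(1) a(1) unfolding k(1) b_def by (auto simp: Let_def)
    have "sat_at (w (\<not> l)) b \<psi>"
      using Until.IH(2)[OF b(3) k(3) const(2), of l] a(2) by simp
    moreover have "datum (w (\<not> l)) b - datum (w (\<not> l)) (i (\<not> l)) \<in> zset J"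
      using b(2) a(3) const(3) by (auto simp: step_same_region_iff[of _ _ _ _ l] same_region_zset_iff)
    moreover have "sat_at (w (\<not> l)) c \<phi>" if "i (\<not> l) < c" "c < b" for c
    proof -
      \<comment> \<open>The challenge \<open>Between c\<close> is answered before the witness
        \<open>a\<close>, where \<phi> is known; the remaining game carries \<phi> back to
        \<open>c\<close>.\<close>
      define e where "e = \<sigma> [Pick l a, Between c]"
      have e: "i l < e" "e < a"
        "survives \<I> w (\<lambda>h. \<sigma> (Pick l a # Between c # h)) k' (place l e c)"
        using between[OF that] by (auto simp: e_def Let_def)
      show ?thesis
        using Until.IH(1)[OF e(3) k(2) const(1), of l] before[OF e(1,2)] by simp
    qed
    ultimately show ?thesis
      using b(1) by auto
  qed
  show ?case
    using transfer[of l] transfer[of "\<not> l"] by (auto simp only: not_not)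
qed

section \<open>Composing a strategy from single rounds\<close>

text \<open>A strategy is never consulted on the empty history.\<close>

lemma survives_cong:
  assumes "\<And>h. h \<noteq> [] \<Longrightarrow> \<sigma> h = \<tau> h"
  shows "survives \<I> w \<sigma> k i \<longleftrightarrow> survives \<I> w \<tau> k i"
  using assms by (cases k) simp_all

text \<open>Histories with different openings never meet, so replies and continuations chosen
  separately for each opening can be glued into one strategy.\<close>

lemma survives_SucI:
  assumes "agree w i"
    and round: "\<And>l a. i l < a \<Longrightarrow> \<exists>b > i (\<not> l). step_same_region \<I> w i (place l a b) \<and>
      (\<exists>\<sigma>. survives \<I> w \<sigma> k (place l a b)) \<and>
      (\<forall>c. i (\<not> l) < c \<and> c < b \<longrightarrow>
         (\<exists>e > i l. e < a \<and> (\<exists>\<sigma>. survives \<I> w \<sigma> k (place l e c))))"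
  shows "\<exists>\<sigma>. survives \<I> w \<sigma> (Suc k) i"
proof -
  from round have "\<forall>l a. \<exists>b. i l < a \<longrightarrow> i (\<not> l) < b \<and> step_same_region \<I> w i (place l a b) \<and>
      (\<exists>\<sigma>. survives \<I> w \<sigma> k (place l a b)) \<and>
      (\<forall>c. i (\<not> l) < c \<and> c < b \<longrightarrow>
         (\<exists>e > i l. e < a \<and> (\<exists>\<sigma>. survives \<I> w \<sigma> k (place l e c))))"
    by blast
  then obtain B where B: "\<And>l a. i l < a \<Longrightarrow> i (\<not> l) < B l a \<and> step_same_region \<I> w i (place l a (B l a)) \<and>
      (\<exists>\<sigma>. survives \<I> w \<sigma> k (place l a (B l a))) \<and>
      (\<forall>c. i (\<not> l) < c \<and> c < B l a \<longrightarrow>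
         (\<exists>e > i l. e < a \<and> (\<exists>\<sigma>. survives \<I> w \<sigma> k (place l e c))))"
    by metis
  then have "\<forall>l a. \<exists>\<sigma>. i l < a \<longrightarrow> survives \<I> w \<sigma> k (place l a (B l a))"
    by blast
  then obtain S where S: "\<And>l a. i l < a \<Longrightarrow> survives \<I> w (S l a) k (place l a (B l a))"
    by metis
  \<comment> \<open>The free value at \<open>[]\<close> stores the reply \<open>e\<close> to
    \<open>Between c\<close>: that reply is what the induced strategy returns when no further move
    has been made.\<close>
  have "\<forall>l a c. \<exists>\<sigma>. i l < a \<and> i (\<not> l) < c \<and> c < B l a \<longrightarrow>
      i l < \<sigma> [] \<and> \<sigma> [] < a \<and> survives \<I> w \<sigma> k (place l (\<sigma> []) c)"
  proof (intro allI)
    fix l a c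
    show "\<exists>\<sigma>. i l < a \<and> i (\<not> l) < c \<and> c < B l a \<longrightarrow>
      i l < \<sigma> [] \<and> \<sigma> [] < a \<and> survives \<I> w \<sigma> k (place l (\<sigma> []) c)"
    proof (cases "i l < a \<and> i (\<not> l) < c \<and> c < B l a")
      case True
      with B obtain e \<sigma> where e: "i l < e" "e < a" "survives \<I> w \<sigma> k (place l e c)"
        by blast
      have "survives \<I> w (\<sigma>([] := e)) k (place l e c)"
        using e(3) by (subst survives_cong[of _ \<sigma>]) auto
      with e(1,2) show ?thesis
        by (intro exI[of _ "\<sigma>([] := e)"]) simp
    qed blast
  qed
  then obtain E where E: "\<And>l a c. i l < a \<Longrightarrow> i (\<not> l) < c \<Longrightarrow> c < B l a \<Longrightarrow>
      i l < E l a c [] \<and> E l a c [] < a \<and> survives \<I> w (E l a c) k (place l (E l a c []) c)"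
    by metis
  \<comment> \<open>The value 0 fills histories at which no reply of Duplicator is due.\<close>
  define \<sigma> where "\<sigma> h = (case h of
      Pick l a # h' \<Rightarrow> (case h' of
        [] \<Rightarrow> B l a
      | Continue # h'' \<Rightarrow> S l a h''
      | Between c # h'' \<Rightarrow> E l a c h''
      | _ \<Rightarrow> 0)
    | _ \<Rightarrow> 0)" for h
  have \<sigma>: "\<sigma> [Pick l a] = B l a" "\<sigma> (Pick l a # Continue # h) = S l a h"
    "\<sigma> (Pick l a # Between c # h) = E l a c h" for l a c h
    by (simp_all add: \<sigma>_def)
  have "survives \<I> w \<sigma> (Suc k) i"
    unfolding survives.simps Let_def \<sigma>
    using assms(1) B S E survives_agree by blast
  then show ?thesis by blast
qed

section \<open>From equal types to winning strategies\<close>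

definition type_at :: "'p mtl set \<Rightarrow> 'p data_word \<Rightarrow> nat \<Rightarrow> 'p mtl set" where
  "type_at F w i = {\<phi> \<in> F. sat_at w i \<phi>}"

text \<open>Over a finite \<open>F\<close> there are finitely many types, each a Boolean condition.
  The induction varies \<open>S\<close>, since removing a formula from \<open>F\<close> splits
  \<open>S\<close> into two conditions on smaller types.\<close>

lemma type_set_definable:
  assumes "finite F"
  shows "\<exists>\<beta>. \<forall>w i. sat_at w i \<beta> \<longleftrightarrow> type_at F w i \<in> S"
  using assms
proof (induction F arbitrary: S rule: finite_induct)
  case empty
  \<comment> \<open>The syntax has no constant for falsity; a contradiction on an arbitrary
    proposition replaces it.\<close>
  define ff :: "'a mtl" where "ff = And (Atom undefined) (Neg (Atom undefined))"
  show ?case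
  proof (cases "{} \<in> S")
    case True
    then show ?thesis
      by (intro exI[of _ "Neg ff"]) (simp add: type_at_def ff_def)
  next
    case False
    then show ?thesis
      by (intro exI[of _ ff]) (simp add: type_at_def ff_def)
  qed
next
  case (insert \<phi> F)
  \<comment> \<open>\<beta> handles the types that contain \<phi>, and \<gamma> those that do not;
    the final formula is the disjunction of the two cases.\<close>
  obtain \<beta> where \<beta>: "\<And>w i. sat_at w i \<beta> \<longleftrightarrow> type_at F w i \<in> {T. insert \<phi> T \<in> S}"
    using insert.IH by blast
  obtain \<gamma> where \<gamma>: "\<And>w i. sat_at w i \<gamma> \<longleftrightarrow> type_at F w i \<in> S"
    using insert.IH by blast
  have "type_at (insert \<phi> F) w i =
      (if sat_at w i \<phi> then insert \<phi> (type_at F w i) else type_at F w i)" for w i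
    by (auto simp: type_at_def)
  then show ?case
    by (intro exI[of _ "Neg (And (Neg (And \<phi> \<beta>)) (Neg (And (Neg \<phi>) \<gamma>)))"]) (simp add: \<beta> \<gamma>)
qed

lemma finite_types_suffice:
  fixes \<I> :: "int extended set" and k :: nat
  assumes "\<I> \<in> FCons"
  obtains F :: "('p :: finite) mtl set" where "finite F"
    "\<And>w i. type_at F (w False) (i False) = type_at F (w True) (i True) \<Longrightarrow>
       \<exists>\<sigma>. survives \<I> w \<sigma> k i"
proof -
  have "\<exists>F :: 'p mtl set. finite F \<and> (\<forall>w i.
      type_at F (w False) (i False) = type_at F (w True) (i True) \<longrightarrow>
        (\<exists>\<sigma>. survives \<I> w \<sigma> k i))"
  proof (induction k)
    case 0
    \<comment> \<open>Without rounds only the propositions count, and \<open>range Atom\<close> is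
      finite because there are finitely many of them.\<close>
    have "agree w i" if "type_at (range Atom) (w False) (i False) =
        type_at (range Atom) (w True) (i True)" for w :: "bool \<Rightarrow> 'p data_word" and i
    proof -
      have "sat_at (w False) (i False) (Atom p) \<longleftrightarrow> sat_at (w True) (i True) (Atom p)" for p
        using that unfolding type_at_def by blast
      then show ?thesis
        by (auto simp: agree_def)
    qed
    then show ?case
      by (intro exI[of _ "range Atom"]) auto
  next
    case (Suc k)
    then obtain F :: "'p mtl set" where F: "finite F"
      "\<And>w i. type_at F (w False) (i False) = type_at F (w True) (i True) \<Longrightarrow>
         \<exists>\<sigma>. survives \<I> w \<sigma> k i"
      by blast
    have win: "\<exists>\<sigma>. survives \<I> w \<sigma> k i"
      if "type_at F (w l) (i l) = type_at F (w (\<not> l)) (i (\<not> l))" for w i l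
      using that by (cases l) (auto intro: F(2))
    obtain \<beta> where \<beta>: "\<And>S w i. sat_at w i (\<beta> S) \<longleftrightarrow> type_at F w i \<in> S"
      using type_set_definable[OF F(1)] by metis
    define U where "U = (\<lambda>(S, J, T). Until (\<beta> S) J (\<beta> {T})) `
      (Pow (Pow F) \<times> {J. endpoints J \<subseteq> \<I>} \<times> Pow F)"
    have "finite (F \<union> U)"
      using F(1) finite_intervals[OF finite_FCons[OF assms]] by (auto simp: U_def)
    moreover have "\<exists>\<sigma>. survives \<I> w \<sigma> (Suc k) i"
      if eq: "type_at (F \<union> U) (w False) (i False) = type_at (F \<union> U) (w True) (i True)" for w i
    proof (rule survives_SucI)
      have same: "sat_at (w l) (i l) \<phi> \<longleftrightarrow> sat_at (w (\<not> l)) (i (\<not> l)) \<phi>" if "\<phi> \<in> F \<union> U" for \<phi> l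
        using eq that unfolding type_at_def by (cases l) auto
      have "type_at F (w False) (i False) = type_at F (w True) (i True)"
        using same[of _ False] by (auto simp: type_at_def)
      \<comment> \<open>Equal \<open>F\<close>-types already give survival for \<open>k\<close>
        rounds, which includes agreement.\<close>
      then show "agree w i"
        using F(2) survives_agree by blast
      fix l a
      assume a: "i l < a"
      let ?\<Delta> = "\<lambda>s b. datum (w s) b - datum (w s) (i s)"
      \<comment> \<open>Taking exactly the types that occur between \<open>i l\<close> and
        \<open>a\<close> serves twice: the until formula holds on side \<open>l\<close>, and every
        type met before \<open>b\<close> on the other side is realised by some \<open>e\<close>
        before \<open>a\<close>.\<close>
      define S where "S = type_at F (w l) ` {i l<..<a}"
      define T where "T = type_at F (w l) a"
      obtain J where J: "endpoints J \<subseteq> \<I>" "?\<Delta> l a \<in> zset J"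
        "\<And>n. n \<in> zset J \<Longrightarrow> same_region \<I> (?\<Delta> l a) n"
        using region_interval[OF assms] by blast
      have "Until (\<beta> S) J (\<beta> {T}) \<in> U"
      proof -
        have "(S, J, T) \<in> Pow (Pow F) \<times> {J. endpoints J \<subseteq> \<I>} \<times> Pow F"
          using J(1) by (auto simp: S_def T_def type_at_def)
        then show ?thesis
          unfolding U_def by (rule rev_image_eqI) simp
      qed
      moreover have "sat_at (w l) (i l) (Until (\<beta> S) J (\<beta> {T}))"
        using a J(2) by (auto simp: \<beta> S_def T_def)
      ultimately have "sat_at (w (\<not> l)) (i (\<not> l)) (Until (\<beta> S) J (\<beta> {T}))"
        using same by blast
      then obtain b where b: "i (\<not> l) < b" "type_at F (w (\<not> l)) b = T" "?\<Delta> (\<not> l) b \<in> zset J"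
        "\<And>c. i (\<not> l) < c \<Longrightarrow> c < b \<Longrightarrow> type_at F (w (\<not> l)) c \<in> S"
        by (auto simp: \<beta>)
      have "step_same_region \<I> w i (place l a b)"
        using J(3)[OF b(3)] by (simp add: step_same_region_iff[of _ _ _ _ l])
      moreover have "\<exists>\<sigma>. survives \<I> w \<sigma> k (place l a b)"
        using b(2) by (intro win[of w l]) (simp add: T_def)
      moreover have "\<exists>e > i l. e < a \<and> (\<exists>\<sigma>. survives \<I> w \<sigma> k (place l e c))"
        if c: "i (\<not> l) < c" "c < b" for c
      proof -
        obtain e where e: "i l < e" "e < a" "type_at F (w l) e = type_at F (w (\<not> l)) c"
          using b(4)[OF c] by (auto simp: S_def)
        then have "\<exists>\<sigma>. survives \<I> w \<sigma> k (place l e c)"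
          by (intro win[of w l]) simp
        with e show ?thesis
          by blast
      qed
      ultimately show "\<exists>b > i (\<not> l). step_same_region \<I> w i (place l a b) \<and>
        (\<exists>\<sigma>. survives \<I> w \<sigma> k (place l a b)) \<and>
        (\<forall>c. i (\<not> l) < c \<and> c < b \<longrightarrow>
           (\<exists>e > i l. e < a \<and> (\<exists>\<sigma>. survives \<I> w \<sigma> k (place l e c))))"
        using b(1) by blast
    qed
    ultimately show ?case
      by blast
  qed
  then show thesis
    using that by blast
qed

section \<open>The characterization of definability\<close>

lemma finite_subset_FCons:
  assumes "finite C"
  obtains \<I> where "\<I> \<in> FCons" "C \<subseteq> \<I>"
proof
  show "Fin ` (Fin -` C) \<union> {Minf, Pinf} \<in> FCons"
    using finite_vimageI[OF assms, of Fin] unfolding FCons_def by (blast intro: injI extended.inject[THEN iffD1])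
  show "C \<subseteq> Fin ` (Fin -` C) \<union> {Minf, Pinf}"
  proof
    fix x
    assume "x \<in> C"
    then show "x \<in> Fin ` (Fin -` C) \<union> {Minf, Pinf}"
      by (cases x) auto
  qed
qed

theorem theorem2:
  fixes L :: "('p :: finite) data_word set"
  shows "\<not> mtl_definable L \<longleftrightarrow>
    (\<forall>\<I>\<in>FCons. \<forall>k::nat. \<exists>w0\<in>L. \<exists>w1. w1 \<notin> L \<and> duplicator_wins_MG \<I> k w0 0 w1 0)"
proof
  assume ndef: "\<not> mtl_definable L"
  show "\<forall>\<I>\<in>FCons. \<forall>k::nat. \<exists>w0\<in>L. \<exists>w1. w1 \<notin> L \<and> duplicator_wins_MG \<I> k w0 0 w1 0"
  proof (intro ballI allI)
    fix \<I> :: "int extended set" and k :: nat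
    assume "\<I> \<in> FCons"
    then obtain F :: "'p mtl set" where F: "finite F"
      "\<And>w i. type_at F (w False) (i False) = type_at F (w True) (i True) \<Longrightarrow>
         \<exists>\<sigma>. survives \<I> w \<sigma> k i"
      using finite_types_suffice by blast
    \<comment> \<open>\<beta> defines the closure of \<open>L\<close> under equality of initial
      \<open>F\<close>-types.\<close>
    obtain \<beta> where \<beta>: "\<And>w i. sat_at w i \<beta> \<longleftrightarrow> type_at F w i \<in> (\<lambda>w. type_at F w 0) ` L"
      using type_set_definable[OF F(1)] by blast
    \<comment> \<open>Every word of \<open>L\<close> satisfies \<beta>, so the discrepancy can only
      be a word outside \<open>L\<close> that shares its type with a word of
      \<open>L\<close>.\<close>
    obtain w1 where "sat w1 \<beta> \<noteq> (w1 \<in> L)"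
      using ndef by (auto simp: mtl_definable_def)
    then obtain w0 where "w0 \<in> L" "w1 \<notin> L" "type_at F w1 0 = type_at F w0 0"
      by (auto simp: sat_def \<beta>)
    then show "\<exists>w0\<in>L. \<exists>w1. w1 \<notin> L \<and> duplicator_wins_MG \<I> k w0 0 w1 0"
      unfolding duplicator_wins_MG_def by (intro bexI[of _ w0] exI[of _ w1] conjI F(2)) simp_all
  qed
next
  assume wins: "\<forall>\<I>\<in>FCons. \<forall>k::nat. \<exists>w0\<in>L. \<exists>w1. w1 \<notin> L \<and> duplicator_wins_MG \<I> k w0 0 w1 0"
  show "\<not> mtl_definable L"
  proof
    assume "mtl_definable L"
    then obtain \<phi> where \<phi>: "\<And>w. sat w \<phi> \<longleftrightarrow> w \<in> L"
      by (auto simp: mtl_definable_def)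
    \<comment> \<open>The defining formula fixes the game to play: its endpoints give \<I>, its
      until-depth the number of rounds.\<close>
    obtain \<I> where \<I>: "\<I> \<in> FCons" "constants \<phi> \<subseteq> \<I>"
      using finite_subset_FCons[OF finite_constants] .
    then obtain w0 w1 where w: "w0 \<in> L" "w1 \<notin> L" "duplicator_wins_MG \<I> (depth \<phi>) w0 0 w1 0"
      using wins by blast
    then obtain \<sigma> where
      "survives \<I> (\<lambda>s. if s then w1 else w0) \<sigma> (depth \<phi>) (\<lambda>s. if s then 0 else 0)"
      by (auto simp only: duplicator_wins_MG_def)
    from survives_sat_at_iff[OF this order_refl \<I>(2), of False]
    have "sat w0 \<phi> \<longleftrightarrow> sat w1 \<phi>"
      by (simp add: sat_def)
    with w \<phi> show False
      by blast
  qed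
qed

end
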